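(* Let $X\sim N_p(\mu,\sigma_X^2 I_p)$ and $Y\sim N_p(\mu,\sigma_Y^2 I_p)$ be independent, with $\sigma_X^2,\sigma_Y^2>0$ known, $\mu\in\mathbb{R}^p$ unknown, and $r=\sigma_X^2/\sigma_Y^2$. Let $0<a<1$, $\hat\mu(X)=aX$, and let $\hat q_{c^2,\hat\mu}$ be the density of $N_p(aX,c^2\sigma_Y^2 I_p)$, viewed as an estimator of the density of $Y$. Then $\hat q_{c^2,\hat\mu}$ dominates $\hat q_{1,\hat\mu}$ under integrated $L_2$ loss if and only if $1<c^2\le k_a(p)$, where $k_a(p)=\infty$ (so that every $c^2>1$ yields dominance) whenever $$p\ge p_0(a)=\frac{2\log 2}{\log\left(1+\frac{a^2r}{2}\right)},$$ and otherwise, when $p<p_0(a)$, $k_a(p)$ is the unique solution in $c^2\in(1,\infty)$ of the equation $$\Big(\frac12\Big)^{p/2}+2\Big(\frac{1}{c^2+a^2r+1}\Big)^{p/2}-2\Big(\frac{1}{a^2r+2}\Big)^{p/2}-\Big(\frac{1}{2c^2}\Big)^{p/2}=0 .$$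
   Context: The integrated $L_2$ loss of an estimate $\hat q(\cdot;x)$ of the density $q(\cdot-\mu)$ of $Y$ is $\int_{\mathbb{R}^p}(q(y-\mu)-\hat q(y;x))^2\,dy$; the risk is its expectation over $X$. One estimator dominates another if its risk is $\le$ for all $\mu\in\mathbb{R}^p$ with strict inequality for some $\mu$. *)

theory Defs
  imports "HOL-Probability.Probability"
begin

text \<open>Density of the isotropic normal law with mean \<open>m\<close> and covariance \<open>v I\<close> (\<open>v\<close> is the
  variance of each coordinate, not the standard deviation) on \<open>real ^ 'p\<close>.\<close>

definition mvn_density :: "real ^ 'p \<Rightarrow> real \<Rightarrow> real ^ 'p \<Rightarrow> real" where
  "mvn_density m v x =
     (2 * pi * v) powr (- real CARD('p) / 2) * exp (- (norm (x - m))\<^sup>2 / (2 * v))"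

text \<open>A predictive density estimator maps an observation \<open>x\<close> to a function of \<open>y\<close>.\<close>

type_synonym 'p pred_estimator = "real ^ 'p \<Rightarrow> real ^ 'p \<Rightarrow> real"

text \<open>Loss and risk take values in \<open>ennreal\<close>, so that a divergent integral is \<open>\<infinity>\<close> and
  not the default value 0 of the Bochner integral.\<close>

definition L2_loss :: "(real ^ 'p \<Rightarrow> real) \<Rightarrow> real ^ 'p \<Rightarrow> (real ^ 'p \<Rightarrow> real) \<Rightarrow> ennreal" where
  "L2_loss q \<mu> f = (\<integral>\<^sup>+ y. ennreal ((q (y - \<mu>) - f y)\<^sup>2) \<partial>lborel)"

text \<open>\<open>M \<mu>\<close> is the probability measure on the sample space when the true parameter is \<open>\<mu>\<close>.\<close>

definition L2_risk ::
  "(real ^ 'p \<Rightarrow> 'w measure) \<Rightarrow> ('w \<Rightarrow> real ^ 'p) \<Rightarrow> (real ^ 'p \<Rightarrow> real) \<Rightarrow>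
   'p pred_estimator \<Rightarrow> real ^ 'p \<Rightarrow> ennreal" where
  "L2_risk M X q qhat \<mu> = (\<integral>\<^sup>+ \<omega>. L2_loss q \<mu> (qhat (X \<omega>)) \<partial>M \<mu>)"

definition dominates ::
  "(real ^ 'p \<Rightarrow> 'w measure) \<Rightarrow> ('w \<Rightarrow> real ^ 'p) \<Rightarrow> (real ^ 'p \<Rightarrow> real) \<Rightarrow>
   'p pred_estimator \<Rightarrow> 'p pred_estimator \<Rightarrow> bool" where
  "dominates M X q qhat1 qhat2 \<longleftrightarrow>
     (\<forall>\<mu>. L2_risk M X q qhat1 \<mu> \<le> L2_risk M X q qhat2 \<mu>) \<and>
     (\<exists>\<mu>. L2_risk M X q qhat1 \<mu> < L2_risk M X q qhat2 \<mu>)"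

text \<open>The estimator \<open>N(muhat(x), c2 vY I)\<close>, where \<open>c2\<close> stands for \<open>c\<^sup>2\<close>.\<close>

definition plugin_density ::
  "real \<Rightarrow> (real ^ 'p \<Rightarrow> real ^ 'p) \<Rightarrow> real \<Rightarrow> 'p pred_estimator" where
  "plugin_density vY muhat c2 x = mvn_density (muhat x) (c2 * vY)"

definition p0 :: "real \<Rightarrow> real \<Rightarrow> real" where
  "p0 r a = 2 * ln 2 / ln (1 + a\<^sup>2 * r / 2)"

definition cutoff_fun :: "real \<Rightarrow> real \<Rightarrow> nat \<Rightarrow> real \<Rightarrow> real" where
  "cutoff_fun r a p c2 =
     (1 / 2) powr (real p / 2) + 2 * (1 / (c2 + a\<^sup>2 * r + 1)) powr (real p / 2)
     - 2 * (1 / (a\<^sup>2 * r + 2)) powr (real p / 2) - (1 / (2 * c2)) powr (real p / 2)"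

definition cutoff :: "real \<Rightarrow> real \<Rightarrow> nat \<Rightarrow> ereal" where
  "cutoff r a p =
     (if real p \<ge> p0 r a then \<infinity> else ereal (THE c2. 1 < c2 \<and> cutoff_fun r a p c2 = 0))"

end

theory Submission
  imports Defs "HOL-Real_Asymp.Real_Asymp"
begin

text \<open>
  Everything reduces to one explicit function of two real variables. Expanding the square, the
  loss of an estimate \<open>g\<close> of a density \<open>f\<close> is \<open>\<integral>f\<^sup>2 + \<integral>g\<^sup>2 - 2 \<integral>f g\<close>, and a product of two normal densities with variances \<open>v\<close> and
  \<open>w\<close> integrates to the normal density with variance \<open>v + w\<close> at the difference of the means
  (\<open>nn_integral_mvn_density_mult\<close>). Averaging over \<open>X\<close> is a second such integral. So with
  \<open>q = p / 2\<close>, \<open>s = 1 + a\<^sup>2 r\<close>, \<open>u = c\<^sup>2\<close> and \<open>t = (1 - a)\<^sup>2 |\<mu>|\<^sup>2 / (2 \<sigma>Y\<^sup>2)\<close> the risk is a positive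
  constant times
  \<open>R(u,t) = (1/2)^q + (1/(2u))^q - 2 (1/(u+s))^q e^(-t/(u+s))\<close>
  (\<open>L2_risk_eq_scaled_risk\<close>). As \<open>a \<noteq> 1\<close>, the parameter \<open>t\<close> takes every value in \<open>[0, \<infinity>)\<close>.

  The gap \<open>R(1,t) - R(u,t)\<close> tends to \<open>(1/2)^q - (1/(2u))^q\<close> as \<open>t \<rightarrow> \<infinity>\<close>. This is negative for
  \<open>u < 1\<close>, which excludes dominance, and positive for \<open>u > 1\<close>, which gives strict improvement far
  from the origin. For \<open>u > 1\<close> the gap is smallest at \<open>t = 0\<close>
  (\<open>scaled_risk_gap_ge_gap_at_zero\<close>), where it equals the function defining the cutoff. Hence
  dominance means that \<open>u > 1\<close> and that this function is nonnegative at \<open>u\<close>.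

  It remains to find the sign of the cutoff function on \<open>(1, \<infinity>)\<close>. It vanishes at \<open>1\<close>, and its
  derivative is a positive multiple of \<open>(2u)^(-q-1) - (u+s)^(-q-1)\<close>, which changes sign exactly
  once, at \<open>u = s\<close>. So the function rises from \<open>0\<close> on \<open>[1, s]\<close> and then falls strictly to its limit
  \<open>(1/2)^q - 2 (1/(s+1))^q\<close>. Taking logarithms, the limit is nonnegative if and only if
  \<open>p \<ge> p0\<close> (\<open>p0_le_iff\<close>). In that case the function stays positive; otherwise it crosses zero once, from
  above (\<open>cutoff_fun_sign_change\<close>).
\<close>

section \<open>Integrals of isotropic normal densities\<close>

lemma mvn_density_nonneg: "0 \<le> mvn_density m v x"
  by (simp add: mvn_density_def)

lemma mvn_density_self:
  fixes m :: "real ^ 'p"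
  shows "mvn_density m v m = (2 * pi * v) powr (- real CARD('p) / 2)"
  by (simp add: mvn_density_def)

lemma borel_measurable_mvn_density [measurable]: "mvn_density m v \<in> borel_measurable borel"
  unfolding mvn_density_def by measurable

text \<open>The covariance is diagonal, so the coordinates separate and integrals reduce to dimension one.\<close>

lemma mvn_density_eq_prod_normal_density:
  fixes m x :: "real ^ 'p"
  assumes "0 < v"
  shows "mvn_density m v x = (\<Prod>b\<in>Basis. normal_density (m \<bullet> b) (sqrt v) (x \<bullet> b))"
proof -
  have norm_sum: "(norm (x - m))\<^sup>2 = (\<Sum>b\<in>Basis. (x \<bullet> b - m \<bullet> b)\<^sup>2)"
    unfolding power2_norm_eq_inner
    by (subst euclidean_inner) (simp add: inner_diff_left power2_eq_square)
  have const: "(1 / sqrt (2 * pi * v)) ^ CARD('p) = (2 * pi * v) powr (- real CARD('p) / 2)"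
  proof -
    have "1 / sqrt (2 * pi * v) = (2 * pi * v) powr (- (1 / 2))"
      using assms by (simp add: powr_minus_divide powr_half_sqrt)
    then have "(1 / sqrt (2 * pi * v)) ^ CARD('p) = ((2 * pi * v) powr (- (1 / 2))) ^ CARD('p)"
      by simp
    also have "\<dots> = ((2 * pi * v) powr (- (1 / 2))) powr real CARD('p)"
      by (rule powr_realpow[symmetric]) (use assms in simp)
    finally show ?thesis
      by (simp add: powr_powr)
  qed
  have "(\<Prod>b\<in>Basis. normal_density (m \<bullet> b) (sqrt v) (x \<bullet> b)) =
      (1 / sqrt (2 * pi * v)) ^ CARD('p) * exp (\<Sum>b\<in>Basis. - (x \<bullet> b - m \<bullet> b)\<^sup>2 / (2 * v))"
    using assms by (simp add: normal_density_def prod.distrib exp_sum DIM_cart prod_dividef power_one_over)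
  also have "(\<Sum>b\<in>Basis. - (x \<bullet> b - m \<bullet> b)\<^sup>2 / (2 * v)) = - (norm (x - m))\<^sup>2 / (2 * v)"
    unfolding norm_sum by (simp add: sum_negf sum_divide_distrib)
  finally show ?thesis
    by (simp add: mvn_density_def const)
qed

text \<open>Translating by \<open>m'\<close> turns the product into the convolution of two centred normal densities.\<close>

lemma nn_integral_normal_density_mult:
  assumes "0 < \<sigma>" "0 < \<tau>"
  shows "(\<integral>\<^sup>+ y. ennreal (normal_density m \<sigma> y * normal_density m' \<tau> y) \<partial>lborel) =
    ennreal (normal_density m (sqrt (\<sigma>\<^sup>2 + \<tau>\<^sup>2)) m')"
proof -
  have "(\<integral>\<^sup>+ y. ennreal (normal_density m \<sigma> y * normal_density m' \<tau> y) \<partial>lborel) =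
      (\<integral>\<^sup>+ y. ennreal (normal_density m \<sigma> (m' + 1 * y) * normal_density m' \<tau> (m' + 1 * y)) \<partial>lborel)"
    by (subst nn_integral_real_affine[where c = 1 and t = m']) auto
  also have "\<dots> = (\<integral>\<^sup>+ y. ennreal (normal_density 0 \<sigma> ((m - m') - y) * normal_density 0 \<tau> y) \<partial>lborel)"
  proof (intro nn_integral_cong)
    fix y
    have "(m' + 1 * y - m)\<^sup>2 = ((m - m') - y - 0)\<^sup>2" and "m' + 1 * y - m' = y - 0"
      by (simp_all add: power2_eq_square algebra_simps)
    then show "ennreal (normal_density m \<sigma> (m' + 1 * y) * normal_density m' \<tau> (m' + 1 * y)) =
        ennreal (normal_density 0 \<sigma> ((m - m') - y) * normal_density 0 \<tau> y)"
      unfolding normal_density_def by simp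
  qed
  also have "\<dots> = ennreal (normal_density 0 (sqrt (\<sigma>\<^sup>2 + \<tau>\<^sup>2)) (m - m'))"
    by (rule fun_cong[OF conv_normal_density_zero_mean[OF assms]])
  also have "\<dots> = ennreal (normal_density m (sqrt (\<sigma>\<^sup>2 + \<tau>\<^sup>2)) m')"
    unfolding normal_density_def by (simp add: power2_commute[of m m'])
  finally show ?thesis .
qed

lemma nn_integral_mvn_density_mult:
  fixes m m' :: "real ^ 'p"
  assumes "0 < v" "0 < w"
  shows "(\<integral>\<^sup>+ y. ennreal (mvn_density m v y * mvn_density m' w y) \<partial>lborel) =
    ennreal (mvn_density m (v + w) m')"
proof -
  have "(\<integral>\<^sup>+ y. ennreal (mvn_density m v y * mvn_density m' w y) \<partial>lborel) =
      (\<integral>\<^sup>+ y. (\<Prod>b\<in>Basis. ennreal (normal_density (m \<bullet> b) (sqrt v) (y \<bullet> b) *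
         normal_density (m' \<bullet> b) (sqrt w) (y \<bullet> b))) \<partial>lborel)"
    using assms by (simp add: mvn_density_eq_prod_normal_density prod_ennreal
        normal_density_nonneg flip: prod.distrib)
  also have "\<dots> = (\<Prod>b\<in>Basis. (\<integral>\<^sup>+ y. ennreal (normal_density (m \<bullet> b) (sqrt v) y *
         normal_density (m' \<bullet> b) (sqrt w) y) \<partial>lborel))"
    by (rule nn_integral_lborel_prod) auto
  also have "\<dots> = ennreal (mvn_density m (v + w) m')"
    using assms by (simp add: nn_integral_normal_density_mult prod_ennreal
        normal_density_nonneg mvn_density_eq_prod_normal_density)
  finally show ?thesis .
qed

text \<open>As a function of \<open>x\<close>, the density at \<open>a x\<close> is again a multiple of a normal density. The
  factor is the inverse Jacobian of the dilation by \<open>a\<close>.\<close>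

lemma mvn_density_scaleR:
  fixes m x :: "real ^ 'p"
  assumes "0 < a" "0 < w"
  shows "mvn_density m w (a *\<^sub>R x) =
    a powr (- real CARD('p)) * mvn_density ((1 / a) *\<^sub>R m) (w / a\<^sup>2) x"
proof -
  have "a *\<^sub>R x - m = a *\<^sub>R (x - (1 / a) *\<^sub>R m)"
    using assms by (simp add: scaleR_diff_right)
  then have norm_eq: "(norm (a *\<^sub>R x - m))\<^sup>2 = a\<^sup>2 * (norm (x - (1 / a) *\<^sub>R m))\<^sup>2"
    by (simp add: power_mult_distrib)
  have "(2 * pi * w) powr (- real CARD('p) / 2) =
      (a\<^sup>2 * (2 * pi * (w / a\<^sup>2))) powr (- real CARD('p) / 2)"
    using assms by simp
  also have "\<dots> = (a powr 2) powr (- real CARD('p) / 2) * (2 * pi * (w / a\<^sup>2)) powr (- real CARD('p) / 2)"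
    using assms by (subst powr_mult) auto
  also have "(a powr 2) powr (- real CARD('p) / 2) = a powr (- real CARD('p))"
    by (simp add: powr_powr)
  finally have "(2 * pi * w) powr (- real CARD('p) / 2) =
      a powr (- real CARD('p)) * (2 * pi * (w / a\<^sup>2)) powr (- real CARD('p) / 2)" .
  then show ?thesis
    using assms by (simp add: mvn_density_def norm_eq)
qed

text \<open>The value is the density at \<open>m\<close> of the sum of \<open>a X\<close> with \<open>X \<sim> N(\<mu>, v I)\<close> and independent centred noise of
  variance \<open>w\<close>: the sum has mean \<open>a \<mu>\<close> and variance \<open>w + a\<^sup>2 v\<close>. It averages the cross term of the loss
  over \<open>X\<close>.\<close>

lemma nn_integral_mvn_density_scaleR:
  fixes m \<mu> :: "real ^ 'p"
  assumes "0 < a" "0 < v" "0 < w"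
  shows "(\<integral>\<^sup>+ x. ennreal (mvn_density \<mu> v x * mvn_density m w (a *\<^sub>R x)) \<partial>lborel) =
    ennreal (mvn_density m (w + a\<^sup>2 * v) (a *\<^sub>R \<mu>))"
proof -
  let ?K = "a powr (- real CARD('p))"
  have "(\<integral>\<^sup>+ x. ennreal (mvn_density \<mu> v x * mvn_density m w (a *\<^sub>R x)) \<partial>lborel) =
      (\<integral>\<^sup>+ x. ennreal ?K * ennreal (mvn_density ((1 / a) *\<^sub>R m) (w / a\<^sup>2) x * mvn_density \<mu> v x) \<partial>lborel)"
    using assms by (simp add: mvn_density_scaleR mult_ac mvn_density_nonneg flip: ennreal_mult')
  also have "\<dots> = ennreal ?K * ennreal (mvn_density ((1 / a) *\<^sub>R m) (w / a\<^sup>2 + v) \<mu>)"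
    using assms by (simp add: nn_integral_cmult nn_integral_mvn_density_mult)
  also have "\<dots> = ennreal (mvn_density m (w + a\<^sup>2 * v) (a *\<^sub>R \<mu>))"
  proof -
    have "w / a\<^sup>2 + v = (w + a\<^sup>2 * v) / a\<^sup>2"
      using assms by (simp add: field_simps)
    moreover have "0 < w + a\<^sup>2 * v"
      using assms by (simp add: add_pos_pos)
    ultimately show ?thesis
      using assms by (simp add: mvn_density_scaleR mvn_density_nonneg flip: ennreal_mult')
  qed
  finally show ?thesis .
qed

section \<open>The risk of a plug-in density\<close>

text \<open>Both the loss and the risk arise by subtracting a cross term from the square terms. Subtraction
  on \<open>ennreal\<close> is truncated, so the pointwise bound of the cross term has to be carried along; its
  integrated form is what makes the next subtraction legitimate.\<close>

lemma nn_integral_diff_real: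
  fixes g k :: "'a \<Rightarrow> real"
  assumes [measurable]: "g \<in> borel_measurable N" "k \<in> borel_measurable N"
    and le: "\<And>x. k x \<le> g x" and nonneg: "\<And>x. 0 \<le> k x" and "0 \<le> G" "0 \<le> K"
    and g: "(\<integral>\<^sup>+ x. ennreal (g x) \<partial>N) = ennreal G"
    and k: "(\<integral>\<^sup>+ x. ennreal (k x) \<partial>N) = ennreal K"
  shows "K \<le> G" and "(\<integral>\<^sup>+ x. ennreal (g x - k x) \<partial>N) = ennreal (G - K)"
proof -
  have "ennreal K \<le> ennreal G"
    unfolding g[symmetric] k[symmetric] by (intro nn_integral_mono ennreal_leI le)
  then show "K \<le> G"
    using assms by simp
  have "(\<integral>\<^sup>+ x. ennreal (g x - k x) \<partial>N) = (\<integral>\<^sup>+ x. ennreal (g x) - ennreal (k x) \<partial>N)"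
    by (simp add: ennreal_minus nonneg)
  also have "\<dots> = (\<integral>\<^sup>+ x. ennreal (g x) \<partial>N) - (\<integral>\<^sup>+ x. ennreal (k x) \<partial>N)"
    by (rule nn_integral_diff) (auto simp: k le ennreal_leI)
  also have "\<dots> = ennreal (G - K)"
    by (simp add: g k ennreal_minus assms)
  finally show "(\<integral>\<^sup>+ x. ennreal (g x - k x) \<partial>N) = ennreal (G - K)" .
qed

lemma L2_loss_mvn_density:
  fixes \<mu> m :: "real ^ 'p"
  assumes v: "0 < v" and w: "0 < w"
  defines "G \<equiv> mvn_density \<mu> (2 * v) \<mu> + mvn_density m (2 * w) m"
  shows "2 * mvn_density \<mu> (v + w) m \<le> G"
    and "L2_loss (mvn_density 0 v) \<mu> (mvn_density m w) = ennreal (G - 2 * mvn_density \<mu> (v + w) m)"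
proof -
  define g where "g y = mvn_density \<mu> v y * mvn_density \<mu> v y + mvn_density m w y * mvn_density m w y"
    for y
  define k where "k y = 2 * (mvn_density \<mu> v y * mvn_density m w y)" for y
  have [measurable]: "g \<in> borel_measurable lborel" "k \<in> borel_measurable lborel"
    unfolding g_def[abs_def] k_def[abs_def] by measurable
  have shift: "mvn_density 0 v (y - \<mu>) = mvn_density \<mu> v y" for y
    by (simp add: mvn_density_def)
  have le: "k y \<le> g y" for y
    using sum_squares_bound[of "mvn_density \<mu> v y" "mvn_density m w y"]
    by (simp add: g_def k_def power2_eq_square)
  have "(\<integral>\<^sup>+ y. ennreal (g y) \<partial>lborel) = ennreal G"
    using v w by (simp add: g_def G_def nn_integral_add nn_integral_mvn_density_mult
        mvn_density_nonneg ennreal_plus flip: mult_2)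
  moreover have "(\<integral>\<^sup>+ y. ennreal (k y) \<partial>lborel) = ennreal (2 * mvn_density \<mu> (v + w) m)"
  proof -
    have "ennreal (k y) = ennreal 2 * ennreal (mvn_density \<mu> v y * mvn_density m w y)" for y
      unfolding k_def by (rule ennreal_mult) (simp_all add: mvn_density_nonneg)
    then have "(\<integral>\<^sup>+ y. ennreal (k y) \<partial>lborel) = ennreal 2 * ennreal (mvn_density \<mu> (v + w) m)"
      using v w by (simp add: nn_integral_cmult nn_integral_mvn_density_mult)
    then show ?thesis
      by (simp add: ennreal_mult mvn_density_nonneg)
  qed
  ultimately have int: "2 * mvn_density \<mu> (v + w) m \<le> G"
      "(\<integral>\<^sup>+ y. ennreal (g y - k y) \<partial>lborel) = ennreal (G - 2 * mvn_density \<mu> (v + w) m)"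
    using nn_integral_diff_real[of g lborel k G "2 * mvn_density \<mu> (v + w) m"] le
    by (auto simp: k_def G_def mvn_density_nonneg)
  show "2 * mvn_density \<mu> (v + w) m \<le> G"
    by (rule int)
  have "(mvn_density 0 v (y - \<mu>) - mvn_density m w y)\<^sup>2 = g y - k y" for y
    by (simp add: shift g_def k_def power2_eq_square algebra_simps)
  then show "L2_loss (mvn_density 0 v) \<mu> (mvn_density m w) =
      ennreal (G - 2 * mvn_density \<mu> (v + w) m)"
    by (simp add: L2_loss_def int)
qed

lemma L2_risk_plugin_density:
  fixes X :: "'w \<Rightarrow> real ^ 'p"
  assumes "prob_space (M \<mu>)"
    and X: "distributed (M \<mu>) lborel X (\<lambda>x. ennreal (mvn_density \<mu> vX x))"
    and pos: "0 < vX" "0 < vY" "0 < a" "0 < u"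
  defines "G \<equiv> mvn_density 0 (2 * vY) (0 :: real ^ 'p) + mvn_density 0 (2 * (u * vY)) (0 :: real ^ 'p)"
    and "K \<equiv> 2 * mvn_density \<mu> (vY + u * vY + a\<^sup>2 * vX) (a *\<^sub>R \<mu>)"
  shows "K \<le> G"
    and "L2_risk M X (mvn_density 0 vY) (plugin_density vY (\<lambda>x. a *\<^sub>R x) u) \<mu> = ennreal (G - K)"
proof -
  interpret prob_space "M \<mu>" by fact
  have [measurable]: "X \<in> borel_measurable (M \<mu>)"
    using distributed_measurable[OF X] by simp
  define k where "k \<omega> = 2 * mvn_density \<mu> (vY + u * vY) (a *\<^sub>R X \<omega>)" for \<omega>
  have w: "0 < u * vY" "0 < vY + u * vY"
    using pos by (simp_all add: add_pos_pos)
  note loss = L2_loss_mvn_density[OF pos(2) w(1)]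
  have [measurable]: "k \<in> borel_measurable (M \<mu>)"
    unfolding k_def[abs_def] by measurable
  have le: "k \<omega> \<le> G" for \<omega>
    using loss(1)[of \<mu> "a *\<^sub>R X \<omega>"] by (simp add: k_def G_def mvn_density_self)
  have "(\<integral>\<^sup>+ \<omega>. ennreal (k \<omega>) \<partial>M \<mu>) =
      2 * (\<integral>\<^sup>+ \<omega>. ennreal (mvn_density \<mu> (vY + u * vY) (a *\<^sub>R X \<omega>)) \<partial>M \<mu>)"
    by (simp add: k_def ennreal_mult'' nn_integral_cmult mvn_density_nonneg)
  also have "(\<integral>\<^sup>+ \<omega>. ennreal (mvn_density \<mu> (vY + u * vY) (a *\<^sub>R X \<omega>)) \<partial>M \<mu>) =
      (\<integral>\<^sup>+ x. ennreal (mvn_density \<mu> vX x * mvn_density \<mu> (vY + u * vY) (a *\<^sub>R x)) \<partial>lborel)"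
    by (subst distributed_nn_integral[OF X, symmetric])
      (simp_all add: ennreal_mult'' mvn_density_nonneg)
  also have "\<dots> = ennreal (mvn_density \<mu> (vY + u * vY + a\<^sup>2 * vX) (a *\<^sub>R \<mu>))"
    by (rule nn_integral_mvn_density_scaleR) (use pos w in auto)
  also have "2 * \<dots> = ennreal K"
    by (simp add: K_def ennreal_mult'' mvn_density_nonneg)
  finally have int_k: "(\<integral>\<^sup>+ \<omega>. ennreal (k \<omega>) \<partial>M \<mu>) = ennreal K" .
  have int: "K \<le> G" "(\<integral>\<^sup>+ \<omega>. ennreal (G - k \<omega>) \<partial>M \<mu>) = ennreal (G - K)"
    using nn_integral_diff_real[of "\<lambda>_. G" "M \<mu>" k G K] le int_k
    by (auto simp: k_def G_def K_def mvn_density_nonneg emeasure_space_1)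
  show "K \<le> G"
    by (rule int)
  have "L2_loss (mvn_density 0 vY) \<mu> (plugin_density vY (\<lambda>x. a *\<^sub>R x) u (X \<omega>)) =
      ennreal (G - k \<omega>)" for \<omega>
    by (simp add: plugin_density_def loss(2) G_def k_def mvn_density_self)
  then show "L2_risk M X (mvn_density 0 vY) (plugin_density vY (\<lambda>x. a *\<^sub>R x) u) \<mu> = ennreal (G - K)"
    by (simp add: L2_risk_def int)
qed

text \<open>The risk up to a positive constant factor. The arguments are \<open>q = p / 2\<close>, \<open>s = 1 + a\<^sup>2 r\<close>, the
  variance inflation \<open>u\<close>, and the rescaled squared distance \<open>t\<close> of \<open>\<mu>\<close> from the origin.\<close>

definition scaled_risk :: "real \<Rightarrow> real \<Rightarrow> real \<Rightarrow> real \<Rightarrow> real" where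
  "scaled_risk q s u t =
     (1 / 2) powr q + (1 / (2 * u)) powr q - 2 * ((1 / (u + s)) powr q * exp (- t / (u + s)))"

lemma L2_risk_eq_scaled_risk:
  fixes X :: "'w \<Rightarrow> real ^ 'p"
  assumes "prob_space (M \<mu>)"
    and "distributed (M \<mu>) lborel X (\<lambda>x. ennreal (mvn_density \<mu> vX x))"
    and pos: "0 < vX" "0 < vY" "0 < a" "0 < u"
  defines "R \<equiv> scaled_risk (real CARD('p) / 2) (1 + a\<^sup>2 * (vX / vY)) u
      ((1 - a)\<^sup>2 * (norm \<mu>)\<^sup>2 / (2 * vY))"
  shows "0 \<le> R"
    and "L2_risk M X (mvn_density 0 vY) (plugin_density vY (\<lambda>x. a *\<^sub>R x) u) \<mu> =
      ennreal ((2 * pi * vY) powr (- real CARD('p) / 2) * R)"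
proof -
  define C where "C = (2 * pi * vY) powr (- real CARD('p) / 2)"
  define G where "G = mvn_density 0 (2 * vY) (0 :: real ^ 'p) + mvn_density 0 (2 * (u * vY)) (0 :: real ^ 'p)"
  define K where "K = 2 * mvn_density \<mu> (vY + u * vY + a\<^sup>2 * vX) (a *\<^sub>R \<mu>)"
  have C: "0 < C"
    using pos by (simp add: C_def)
  \<comment> \<open>All variances that occur are multiples of \<open>vY\<close>; this pulls out their common factor \<open>C\<close>.\<close>
  have density: "mvn_density m (vY * w) x =
      C * ((1 / w) powr (real CARD('p) / 2) * exp (- ((norm (x - m))\<^sup>2 / (2 * vY)) / w))"
    if "0 < w" for w and m x :: "real ^ 'p"
  proof -
    have "(2 * pi * (vY * w)) powr (- real CARD('p) / 2) = C * w powr (- (real CARD('p) / 2))"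
      using that pos by (simp add: C_def powr_mult flip: mult.assoc)
    also have "w powr (- (real CARD('p) / 2)) = (1 / w) powr (real CARD('p) / 2)"
      using that by (simp add: powr_minus_divide powr_divide)
    finally show ?thesis
      by (simp add: mvn_density_def mult.assoc)
  qed
  have "a *\<^sub>R \<mu> - \<mu> = - ((1 - a) *\<^sub>R \<mu>)"
    by (simp add: algebra_simps)
  then have norm_eq: "(norm (a *\<^sub>R \<mu> - \<mu>))\<^sup>2 = (1 - a)\<^sup>2 * (norm \<mu>)\<^sup>2"
    by (simp add: power_mult_distrib)
  have var: "vY + u * vY + a\<^sup>2 * vX = vY * (u + (1 + a\<^sup>2 * (vX / vY)))"
    using pos by (simp add: field_simps)
  have var_pos: "0 < u + (1 + a\<^sup>2 * (vX / vY))"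
    using pos by (simp add: add_pos_nonneg)
  have "G - K = C * R"
    using pos density[of 2 0 0] density[of "2 * u" 0 0] density[OF var_pos, of \<mu> "a *\<^sub>R \<mu>"]
    unfolding G_def K_def R_def scaled_risk_def var norm_eq
    by (simp add: algebra_simps)
  moreover have "K \<le> G"
    "L2_risk M X (mvn_density 0 vY) (plugin_density vY (\<lambda>x. a *\<^sub>R x) u) \<mu> = ennreal (G - K)"
    unfolding G_def K_def by (rule L2_risk_plugin_density[where M = M and \<mu> = \<mu>, OF assms(1,2) pos])+
  ultimately show "0 \<le> R"
    "L2_risk M X (mvn_density 0 vY) (plugin_density vY (\<lambda>x. a *\<^sub>R x) u) \<mu> =
      ennreal ((2 * pi * vY) powr (- real CARD('p) / 2) * R)"
    using C mult_less_0_iff[of C R] by (auto simp: C_def not_less[symmetric])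
qed

section \<open>Reduction to the origin\<close>

lemma scaled_risk_gap_at_zero:
  "scaled_risk (real n / 2) (1 + a\<^sup>2 * r) 1 0 - scaled_risk (real n / 2) (1 + a\<^sup>2 * r) u 0 =
    cutoff_fun r a n u"
  by (simp add: scaled_risk_def cutoff_fun_def algebra_simps)

text \<open>Apart from a constant, half the gap is \<open>A e^(-\<alpha> t) - B e^(-\<beta> t)\<close> with \<open>A \<le> B\<close> and
  \<open>\<alpha> \<le> \<beta>\<close>. Replacing \<open>\<alpha>\<close> by the larger \<open>\<beta>\<close> decreases it to \<open>e^(-\<beta> t) (A - B)\<close>, and damping the
  nonpositive number \<open>A - B\<close> can only increase it.\<close>

lemma scaled_risk_gap_ge_gap_at_zero:
  assumes "0 \<le> q" "0 < s" "1 < u" "0 \<le> t"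
  shows "scaled_risk q s 1 0 - scaled_risk q s u 0 \<le> scaled_risk q s 1 t - scaled_risk q s u t"
proof -
  define A B where "A = (1 / (u + s)) powr q" and "B = (1 / (1 + s)) powr q"
  define \<alpha> \<beta> where "\<alpha> = 1 / (u + s)" and "\<beta> = 1 / (1 + s)"
  have "\<alpha> \<le> \<beta>" "0 \<le> \<alpha>" "0 \<le> \<beta>"
    using assms by (auto simp: \<alpha>_def \<beta>_def frac_le)
  have AB: "A \<le> B" "0 \<le> A"
    unfolding A_def B_def using assms by (auto intro!: powr_mono2 frac_le)
  have "A - B \<le> exp (- (\<beta> * t)) * (A - B)"
    using AB \<open>0 \<le> \<beta>\<close> \<open>0 \<le> t\<close> mult_right_mono[of "exp (- (\<beta> * t))" 1 "B - A"]
    by (simp add: algebra_simps)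
  also have "\<dots> \<le> A * exp (- (\<alpha> * t)) - B * exp (- (\<beta> * t))"
    using AB \<open>\<alpha> \<le> \<beta>\<close> \<open>0 \<le> t\<close> mult_left_mono[of "exp (- (\<beta> * t))" "exp (- (\<alpha> * t))" A]
    by (simp add: algebra_simps mult_right_mono)
  finally show ?thesis
    by (simp add: scaled_risk_def A_def B_def \<alpha>_def \<beta>_def)
qed

lemma scaled_risk_gap_tendsto:
  assumes "0 < s" "0 < u"
  shows "((\<lambda>t. scaled_risk q s 1 t - scaled_risk q s u t) \<longlongrightarrow>
    (1 / 2) powr q - (1 / (2 * u)) powr q) at_top"
proof -
  have exp_0: "((\<lambda>t. exp (- t / w)) \<longlongrightarrow> 0) at_top" if "0 < w" for w :: real
    using that by real_asymp
  have lim: "((\<lambda>t. scaled_risk q s w t) \<longlongrightarrow>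
      (1 / 2) powr q + (1 / (2 * w)) powr q - 2 * ((1 / (w + s)) powr q * 0)) at_top" if "0 < w" for w
    unfolding scaled_risk_def using assms that
    by (intro tendsto_intros exp_0) auto
  show ?thesis
    using tendsto_diff[OF lim[of 1] lim[of u]] assms by simp
qed

section \<open>The shape of the cutoff function\<close>

text \<open>Powers with a negative exponent, with \<open>s = 1 + a\<^sup>2 r\<close> kept together, make the derivative and its
  sign visible.\<close>

lemma cutoff_fun_altdef:
  assumes "0 < u" "0 \<le> a\<^sup>2 * r"
  shows "cutoff_fun r a n u = 2 powr (- (real n / 2)) + 2 * (u + (1 + a\<^sup>2 * r)) powr (- (real n / 2))
    - 2 * (2 + a\<^sup>2 * r) powr (- (real n / 2)) - (2 * u) powr (- (real n / 2))"
  using assms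
  by (simp add: cutoff_fun_def powr_minus_divide powr_divide add_ac)

lemma cutoff_fun_1: "cutoff_fun r a n 1 = 0"
  by (simp add: cutoff_fun_def algebra_simps)

lemma cutoff_fun_has_derivative:
  assumes "0 < u" "0 \<le> a\<^sup>2 * r"
  shows "(cutoff_fun r a n has_real_derivative
    real n * ((2 * u) powr (- (real n / 2) - 1) - (u + (1 + a\<^sup>2 * r)) powr (- (real n / 2) - 1))) (at u)"
proof (subst DERIV_cong_ev[OF refl _ refl])
  have "\<forall>\<^sub>F x in nhds u. 0 < x"
    using assms by (intro eventually_nhds_in_open[of "{0<..}", simplified]) auto
  then show "\<forall>\<^sub>F x in nhds u. cutoff_fun r a n x =
      2 powr (- (real n / 2)) + 2 * (x + (1 + a\<^sup>2 * r)) powr (- (real n / 2))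
      - 2 * (2 + a\<^sup>2 * r) powr (- (real n / 2)) - (2 * x) powr (- (real n / 2))"
    by eventually_elim (rule cutoff_fun_altdef[OF _ assms(2)])
qed (use assms in \<open>auto intro!: derivative_eq_intros simp: algebra_simps\<close>)

lemma isCont_cutoff_fun:
  assumes "0 < u" "0 \<le> a\<^sup>2 * r"
  shows "isCont (cutoff_fun r a n) u"
  by (rule DERIV_isCont[OF cutoff_fun_has_derivative[OF assms]])

text \<open>The derivative has the sign of \<open>(u + s) - 2 u = s - u\<close>, where \<open>s = 1 + a\<^sup>2 r\<close>. So the peak is at
  \<open>s\<close>, independently of the dimension.\<close>

lemma cutoff_fun_strict_increasing:
  assumes "0 < n" "0 \<le> a\<^sup>2 * r" "0 < u" "u < v" "v \<le> 1 + a\<^sup>2 * r"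
  shows "cutoff_fun r a n u < cutoff_fun r a n v"
proof (rule DERIV_pos_imp_increasing_open[OF \<open>u < v\<close>])
  fix x assume "u < x" "x < v"
  then have "(x + (1 + a\<^sup>2 * r)) powr (- (real n / 2) - 1) < (2 * x) powr (- (real n / 2) - 1)"
    using assms by (intro powr_less_mono2_neg) (auto simp: add_neg_nonpos)
  then have "0 < real n * ((2 * x) powr (- (real n / 2) - 1) - (x + (1 + a\<^sup>2 * r)) powr (- (real n / 2) - 1))"
    using \<open>0 < n\<close> by simp
  moreover have "0 < x"
    using \<open>u < x\<close> \<open>0 < u\<close> by simp
  ultimately show "\<exists>y. DERIV (cutoff_fun r a n) x :> y \<and> 0 < y"
    using cutoff_fun_has_derivative assms(2) by blast
next
  show "continuous_on {u..v} (cutoff_fun r a n)"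
    using assms by (intro continuous_at_imp_continuous_on ballI isCont_cutoff_fun) auto
qed

lemma cutoff_fun_strict_decreasing:
  assumes "0 < n" "0 \<le> a\<^sup>2 * r" "1 + a\<^sup>2 * r \<le> u" "u < v"
  shows "cutoff_fun r a n v < cutoff_fun r a n u"
proof (rule DERIV_neg_imp_decreasing_open[OF \<open>u < v\<close>])
  fix x assume x: "u < x" "x < v"
  then have "0 < x"
    using assms by linarith
  then have "(2 * x) powr (- (real n / 2) - 1) < (x + (1 + a\<^sup>2 * r)) powr (- (real n / 2) - 1)"
    using assms x by (intro powr_less_mono2_neg) (auto simp: add_neg_nonpos)
  then have "real n * ((2 * x) powr (- (real n / 2) - 1) - (x + (1 + a\<^sup>2 * r)) powr (- (real n / 2) - 1)) < 0"
    using \<open>0 < n\<close> by (simp add: mult_less_0_iff)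
  then show "\<exists>y. DERIV (cutoff_fun r a n) x :> y \<and> y < 0"
    using cutoff_fun_has_derivative \<open>0 < x\<close> assms(2) by blast
next
  show "continuous_on {u..v} (cutoff_fun r a n)"
    using assms by (intro continuous_at_imp_continuous_on ballI isCont_cutoff_fun) auto
qed

lemma cutoff_fun_tendsto:
  assumes "0 < n"
  shows "(cutoff_fun r a n \<longlongrightarrow>
    (1 / 2) powr (real n / 2) - 2 * (1 / (a\<^sup>2 * r + 2)) powr (real n / 2)) at_top"
proof -
  define q where "q = real n / 2"
  have q: "0 < q"
    using assms by (simp add: q_def)
  have "((\<lambda>u. (1 / (u + a\<^sup>2 * r + 1)) powr q) \<longlongrightarrow> 0) at_top"
    "((\<lambda>u. (1 / (2 * u)) powr q) \<longlongrightarrow> 0) at_top"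
    using q by real_asymp+
  then have "((\<lambda>u. (1 / 2) powr q + 2 * (1 / (u + a\<^sup>2 * r + 1)) powr q
      - 2 * (1 / (a\<^sup>2 * r + 2)) powr q - (1 / (2 * u)) powr q) \<longlongrightarrow>
      (1 / 2) powr q + 2 * 0 - 2 * (1 / (a\<^sup>2 * r + 2)) powr q - 0) at_top"
    by (intro tendsto_intros)
  then show ?thesis
    by (simp add: cutoff_fun_def[abs_def] q_def)
qed

text \<open>The threshold \<open>p0\<close> is the dimension at which the limit of the cutoff function at infinity
  changes sign.\<close>

lemma p0_le_iff:
  assumes "0 < a\<^sup>2 * r"
  shows "p0 r a \<le> real n \<longleftrightarrow>
    0 \<le> (1 / 2) powr (real n / 2) - 2 * (1 / (a\<^sup>2 * r + 2)) powr (real n / 2)"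
proof -
  define q b where "q = real n / 2" and "b = a\<^sup>2 * r"
  have b: "0 < b"
    using assms by (simp add: b_def)
  have "0 \<le> (1 / 2) powr q - 2 * (1 / (b + 2)) powr q \<longleftrightarrow>
      ln (2 * (1 / (b + 2)) powr q) \<le> ln ((1 / 2) powr q)"
    using b by (subst ln_le_cancel_iff) auto
  also have "\<dots> \<longleftrightarrow> ln 2 \<le> q * (ln (b + 2) - ln 2)"
    using b by (simp add: ln_mult ln_powr ln_div algebra_simps)
  also have "ln (b + 2) - ln 2 = ln (1 + b / 2)"
    using b ln_div[of "b + 2" 2] by (simp add: add_divide_distrib add.commute)
  also have "ln 2 \<le> q * ln (1 + b / 2) \<longleftrightarrow> p0 r a \<le> real n"
    using b unfolding p0_def b_def[symmetric] by (simp add: q_def divide_le_eq mult.commute)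
  finally show ?thesis
    by (simp add: q_def b_def)
qed

lemma cutoff_fun_gt_limit:
  assumes "0 < n" "0 \<le> a\<^sup>2 * r" "1 + a\<^sup>2 * r \<le> u"
  shows "(1 / 2) powr (real n / 2) - 2 * (1 / (a\<^sup>2 * r + 2)) powr (real n / 2) < cutoff_fun r a n u"
proof -
  \<comment> \<open>Comparing the limit with \<open>u + 1\<close> instead of \<open>u\<close> makes the final inequality strict.\<close>
  have "\<forall>\<^sub>F v in at_top. cutoff_fun r a n v \<le> cutoff_fun r a n (u + 1)"
  proof (rule eventually_at_top_linorderI)
    fix v assume "u + 1 \<le> v"
    then show "cutoff_fun r a n v \<le> cutoff_fun r a n (u + 1)"
      using cutoff_fun_strict_decreasing[of n a r "u + 1" v] assms by (cases "v = u + 1") auto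
  qed
  then have "(1 / 2) powr (real n / 2) - 2 * (1 / (a\<^sup>2 * r + 2)) powr (real n / 2) \<le>
      cutoff_fun r a n (u + 1)"
    by (rule tendsto_upperbound[OF cutoff_fun_tendsto[OF \<open>0 < n\<close>]]) simp
  also have "\<dots> < cutoff_fun r a n u"
    using assms by (intro cutoff_fun_strict_decreasing) auto
  finally show ?thesis .
qed

lemma cutoff_fun_pos_up_to_peak:
  assumes "0 < n" "0 \<le> a\<^sup>2 * r" "1 < u" "u \<le> 1 + a\<^sup>2 * r"
  shows "0 < cutoff_fun r a n u"
  using cutoff_fun_strict_increasing[of n a r 1 u] assms by (simp add: cutoff_fun_1)

lemma cutoff_fun_pos_of_p0_le:
  assumes "0 < n" "0 < a\<^sup>2 * r" "p0 r a \<le> real n" "1 < u"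
  shows "0 < cutoff_fun r a n u"
proof (cases "u \<le> 1 + a\<^sup>2 * r")
  case True
  then show ?thesis
    using assms by (intro cutoff_fun_pos_up_to_peak) auto
next
  case False
  then show ?thesis
    using assms cutoff_fun_gt_limit[of n a r u] p0_le_iff[of a r n] by simp
qed

text \<open>With a negative limit, the intermediate value theorem gives a zero beyond the peak, and strict
  decrease there makes it the only sign change.\<close>

lemma cutoff_fun_sign_change:
  assumes "0 < n" "0 < a\<^sup>2 * r" "real n < p0 r a"
  obtains k where "1 < k" "cutoff_fun r a n k = 0"
    "\<And>u. 1 < u \<Longrightarrow> u < k \<Longrightarrow> 0 < cutoff_fun r a n u"
    "\<And>u. k < u \<Longrightarrow> cutoff_fun r a n u < 0"
proof -
  define s where "s = 1 + a\<^sup>2 * r"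
  have s: "1 < s"
    using assms by (simp add: s_def)
  have peak: "0 < cutoff_fun r a n s"
    using assms s by (intro cutoff_fun_pos_up_to_peak) (auto simp: s_def)
  have dec: "cutoff_fun r a n v < cutoff_fun r a n u" if "s \<le> u" "u < v" for u v
    using assms that by (intro cutoff_fun_strict_decreasing) (auto simp: s_def)
  have "(1 / 2) powr (real n / 2) - 2 * (1 / (a\<^sup>2 * r + 2)) powr (real n / 2) < 0"
    using assms p0_le_iff[of a r n] by linarith
  then have "\<forall>\<^sub>F u in at_top. cutoff_fun r a n u < 0"
    by (rule order_tendstoD[OF cutoff_fun_tendsto[OF \<open>0 < n\<close>]])
  then have "\<forall>\<^sub>F u in at_top. cutoff_fun r a n u < 0 \<and> s \<le> u"
    using eventually_ge_at_top by (rule eventually_conj)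
  then obtain w where w: "cutoff_fun r a n w < 0" "s \<le> w"
    using eventually_happens'[OF trivial_limit_at_top_linorder] by blast
  have "\<exists>k. s \<le> k \<and> k \<le> w \<and> cutoff_fun r a n k = 0"
    using w peak s assms by (intro IVT2 allI impI isCont_cutoff_fun) auto
  then obtain k where k: "s \<le> k" "cutoff_fun r a n k = 0"
    by blast
  show thesis
  proof
    show "1 < k" "cutoff_fun r a n k = 0"
      using k s by auto
    show "0 < cutoff_fun r a n u" if "1 < u" "u < k" for u
    proof (cases "u \<le> s")
      case True
      then show ?thesis
        using assms that by (intro cutoff_fun_pos_up_to_peak) (auto simp: s_def)
    next
      case False
      then show ?thesis
        using dec[of u k] k that by simp
    qed
    show "cutoff_fun r a n u < 0" if "k < u" for u
      using dec[of k u] k that by simp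
  qed
qed

lemma ex1_cutoff_fun_root:
  assumes "0 < n" "0 < a\<^sup>2 * r" "real n < p0 r a"
  shows "\<exists>!u. 1 < u \<and> cutoff_fun r a n u = 0"
  using cutoff_fun_sign_change[OF assms] by (metis less_irrefl linorder_neqE)

lemma cutoff_fun_nonneg_iff_le_cutoff:
  assumes "0 < n" "0 < a\<^sup>2 * r" "1 < u"
  shows "0 \<le> cutoff_fun r a n u \<longleftrightarrow> ereal u \<le> cutoff r a n"
proof (cases "p0 r a \<le> real n")
  case True
  then show ?thesis
    using assms cutoff_fun_pos_of_p0_le[of n a r u] by (simp add: cutoff_def)
next
  case False
  then have "real n < p0 r a"
    by simp
  then obtain k where k: "1 < k" "cutoff_fun r a n k = 0"
    "\<And>u. 1 < u \<Longrightarrow> u < k \<Longrightarrow> 0 < cutoff_fun r a n u"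
    "\<And>u. k < u \<Longrightarrow> cutoff_fun r a n u < 0"
    using cutoff_fun_sign_change assms(1,2) by blast
  have "(THE c2. 1 < c2 \<and> cutoff_fun r a n c2 = 0) = k"
    using k by (intro the1_equality ex1_cutoff_fun_root assms \<open>real n < p0 r a\<close>) auto
  then have "cutoff r a n = ereal k"
    using False by (simp add: cutoff_def)
  then show ?thesis
    using k(2) k(3)[OF assms(3)] k(4)[of u] by (cases u k rule: linorder_cases) auto
qed

section \<open>Dominance\<close>

text \<open>The risk depends on \<open>\<mu>\<close> only through \<open>t\<close>, and \<open>t\<close> ranges over all of \<open>[0, \<infinity>)\<close> because
  \<open>a \<noteq> 1\<close> and vectors of every length exist.\<close>

lemma dominates_plugin_density_iff_scaled_risk:
  fixes M :: "real ^ 'p \<Rightarrow> 'w measure"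
  assumes prob: "\<And>\<mu>. prob_space (M \<mu>)"
    and X: "\<And>\<mu>. distributed (M \<mu>) lborel X (\<lambda>x. ennreal (mvn_density \<mu> vX x))"
    and pos: "0 < vX" "0 < vY" and a: "0 < a" "a \<noteq> 1" and u: "0 < u"
  defines "R \<equiv> scaled_risk (real CARD('p) / 2) (1 + a\<^sup>2 * (vX / vY))"
  shows "dominates M X (mvn_density 0 vY)
      (plugin_density vY (\<lambda>x. a *\<^sub>R x) u) (plugin_density vY (\<lambda>x. a *\<^sub>R x) 1) \<longleftrightarrow>
    (\<forall>t\<ge>0. R u t \<le> R 1 t) \<and> (\<exists>t\<ge>0. R u t < R 1 t)"
proof -
  define C where "C = (2 * pi * vY) powr (- real CARD('p) / 2)"
  define T where "T \<mu> = (1 - a)\<^sup>2 * (norm \<mu>)\<^sup>2 / (2 * vY)" for \<mu> :: "real ^ 'p"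
  have C: "0 < C"
    using pos by (simp add: C_def)
  have risk: "L2_risk M X (mvn_density 0 vY) (plugin_density vY (\<lambda>x. a *\<^sub>R x) w) \<mu> =
      ennreal (C * R w (T \<mu>))" and nonneg: "0 \<le> R w (T \<mu>)" if "0 < w" for w \<mu>
    using L2_risk_eq_scaled_risk[where M = M and \<mu> = \<mu>, OF prob X pos a(1) that] by (simp_all add: C_def R_def T_def)
  have le: "L2_risk M X (mvn_density 0 vY) (plugin_density vY (\<lambda>x. a *\<^sub>R x) u) \<mu> \<le>
      L2_risk M X (mvn_density 0 vY) (plugin_density vY (\<lambda>x. a *\<^sub>R x) 1) \<mu> \<longleftrightarrow>
      R u (T \<mu>) \<le> R 1 (T \<mu>)" for \<mu>
    using C nonneg[OF u] nonneg[of 1] by (simp add: risk u)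
  have less: "L2_risk M X (mvn_density 0 vY) (plugin_density vY (\<lambda>x. a *\<^sub>R x) u) \<mu> <
      L2_risk M X (mvn_density 0 vY) (plugin_density vY (\<lambda>x. a *\<^sub>R x) 1) \<mu> \<longleftrightarrow>
      R u (T \<mu>) < R 1 (T \<mu>)" for \<mu>
    using C nonneg[OF u] nonneg[of 1] by (simp add: risk u ennreal_less_iff)
  have "T ` UNIV = {0..}"
  proof (intro equalityI subsetI)
    fix t :: real assume "t \<in> {0..}"
    then obtain \<mu> :: "real ^ 'p" where "norm \<mu> = sqrt (2 * vY * t / (1 - a)\<^sup>2)"
      using pos vector_choose_size[of "sqrt (2 * vY * t / (1 - a)\<^sup>2)"] by auto
    then have "T \<mu> = t"
      using pos a \<open>t \<in> {0..}\<close> by (simp add: T_def)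
    then show "t \<in> T ` UNIV"
      by blast
  qed (use pos in \<open>auto simp: T_def\<close>)
  then have image: "(\<forall>\<mu>. P (T \<mu>)) \<longleftrightarrow> (\<forall>t\<ge>0. P t)" "(\<exists>\<mu>. P (T \<mu>)) \<longleftrightarrow> (\<exists>t\<ge>0. P t)" for P
    by (metis atLeast_iff image_iff UNIV_I)+
  show ?thesis
    unfolding dominates_def le less
    using image(1)[of "\<lambda>t. R u t \<le> R 1 t"] image(2)[of "\<lambda>t. R u t < R 1 t"] by simp
qed

text \<open>The behaviour as \<open>t \<rightarrow> \<infinity>\<close> forces \<open>u > 1\<close> and supplies the strict inequality; the value at
  \<open>t = 0\<close> decides the rest, being the smallest gap.\<close>

lemma scaled_risk_dominance_iff:
  fixes n :: nat
  assumes n: "0 < n" and b: "0 \<le> a\<^sup>2 * r" and u: "0 < u"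
  defines "R \<equiv> scaled_risk (real n / 2) (1 + a\<^sup>2 * r)"
  shows "(\<forall>t\<ge>0. R u t \<le> R 1 t) \<and> (\<exists>t\<ge>0. R u t < R 1 t) \<longleftrightarrow>
    1 < u \<and> 0 \<le> cutoff_fun r a n u"
proof -
  have at_0: "R 1 0 - R u 0 = cutoff_fun r a n u"
    unfolding R_def by (rule scaled_risk_gap_at_zero)
  have lim: "((\<lambda>t. R 1 t - R u t) \<longlongrightarrow> (1 / 2) powr (real n / 2) - (1 / (2 * u)) powr (real n / 2)) at_top"
    unfolding R_def using b u by (intro scaled_risk_gap_tendsto) auto
  show ?thesis
  proof (intro iffI conjI)
    assume dom: "(\<forall>t\<ge>0. R u t \<le> R 1 t) \<and> (\<exists>t\<ge>0. R u t < R 1 t)"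
    then show "0 \<le> cutoff_fun r a n u"
      using at_0 by (metis diff_ge_0_iff_ge order_refl)
    have "\<forall>\<^sub>F t in at_top. 0 \<le> R 1 t - R u t"
      using eventually_ge_at_top[of 0] by eventually_elim (use dom in auto)
    then have "0 \<le> (1 / 2) powr (real n / 2) - (1 / (2 * u)) powr (real n / 2)"
      by (rule tendsto_lowerbound[OF lim]) simp
    moreover have "(1 / 2) powr (real n / 2) < (1 / (2 * u)) powr (real n / 2)" if "u < 1"
      using that u n by (intro powr_less_mono2) (auto simp: field_simps)
    ultimately have "1 \<le> u"
      by (cases "u < 1") auto
    moreover have "u \<noteq> 1"
      using dom by auto
    ultimately show "1 < u"
      by simp
  next
    assume rhs: "1 < u \<and> 0 \<le> cutoff_fun r a n u"
    have "0 \<le> R 1 t - R u t" if "0 \<le> t" for t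
    proof -
      have "0 \<le> R 1 0 - R u 0"
        using rhs at_0 by simp
      also have "\<dots> \<le> R 1 t - R u t"
        unfolding R_def using rhs b that by (intro scaled_risk_gap_ge_gap_at_zero) auto
      finally show ?thesis .
    qed
    then show "\<forall>t\<ge>0. R u t \<le> R 1 t"
      by simp
    have "(1 / (2 * u)) powr (real n / 2) < (1 / 2) powr (real n / 2)"
      using rhs n by (intro powr_less_mono2) (auto simp: field_simps)
    then have "\<forall>\<^sub>F t in at_top. 0 < R 1 t - R u t"
      by (intro order_tendstoD[OF lim]) simp
    then have "\<forall>\<^sub>F t in at_top. 0 < R 1 t - R u t \<and> 0 \<le> t"
      using eventually_ge_at_top by (rule eventually_conj)
    then obtain t where "0 < R 1 t - R u t" "0 \<le> t"
      using eventually_happens'[OF trivial_limit_at_top_linorder] by blast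
    then show "\<exists>t\<ge>0. R u t < R 1 t"
      by auto
  qed
qed

theorem theorem3p1:
  fixes M :: "real ^ 'p \<Rightarrow> 'w measure"
    and X Y :: "'w \<Rightarrow> real ^ 'p"
    and \<sigma>X \<sigma>Y a c r :: real
  assumes "\<sigma>X > 0" and "\<sigma>Y > 0"
    and "\<And>\<mu>. prob_space (M \<mu>)"
    and "\<And>\<mu>. distributed (M \<mu>) lborel X (\<lambda>x. ennreal (mvn_density \<mu> (\<sigma>X\<^sup>2) x))"
    and "\<And>\<mu>. distributed (M \<mu>) lborel Y (\<lambda>y. ennreal (mvn_density \<mu> (\<sigma>Y\<^sup>2) y))"
    and "\<And>\<mu>. prob_space.indep_var (M \<mu>) borel X borel Y"
    and "r = \<sigma>X\<^sup>2 / \<sigma>Y\<^sup>2"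
    and "0 < a" and "a < 1"
    and "c > 0"
  shows "(real CARD('p) < p0 r a \<longrightarrow> (\<exists>!c2. 1 < c2 \<and> cutoff_fun r a CARD('p) c2 = 0)) \<and>
    (dominates M X (mvn_density 0 (\<sigma>Y\<^sup>2))
        (plugin_density (\<sigma>Y\<^sup>2) (\<lambda>x. a *\<^sub>R x) (c\<^sup>2)) (plugin_density (\<sigma>Y\<^sup>2) (\<lambda>x. a *\<^sub>R x) 1)
      \<longleftrightarrow> 1 < c\<^sup>2 \<and> ereal (c\<^sup>2) \<le> cutoff r a CARD('p))"
proof (intro conjI impI)
  have var_pos: "0 < \<sigma>X\<^sup>2" "0 < \<sigma>Y\<^sup>2"
    using assms(1,2) by simp_all
  have b: "0 < a\<^sup>2 * r"
    using assms(7,8) var_pos by simp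
  show "\<exists>!c2. 1 < c2 \<and> cutoff_fun r a CARD('p) c2 = 0" if "real CARD('p) < p0 r a"
    by (rule ex1_cutoff_fun_root[OF _ b that]) simp
  have "dominates M X (mvn_density 0 (\<sigma>Y\<^sup>2))
        (plugin_density (\<sigma>Y\<^sup>2) (\<lambda>x. a *\<^sub>R x) (c\<^sup>2)) (plugin_density (\<sigma>Y\<^sup>2) (\<lambda>x. a *\<^sub>R x) 1)
      \<longleftrightarrow> 1 < c\<^sup>2 \<and> 0 \<le> cutoff_fun r a CARD('p) (c\<^sup>2)"
    using dominates_plugin_density_iff_scaled_risk[OF assms(3,4) var_pos, of a "c\<^sup>2"]
      scaled_risk_dominance_iff[of "CARD('p)" a r "c\<^sup>2"] assms(7-10) b by simp
  also have "\<dots> \<longleftrightarrow> 1 < c\<^sup>2 \<and> ereal (c\<^sup>2) \<le> cutoff r a CARD('p)"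
    using cutoff_fun_nonneg_iff_le_cutoff[of "CARD('p)" a r "c\<^sup>2"] b by auto
  finally show "dominates M X (mvn_density 0 (\<sigma>Y\<^sup>2))
        (plugin_density (\<sigma>Y\<^sup>2) (\<lambda>x. a *\<^sub>R x) (c\<^sup>2)) (plugin_density (\<sigma>Y\<^sup>2) (\<lambda>x. a *\<^sub>R x) 1)
      \<longleftrightarrow> 1 < c\<^sup>2 \<and> ereal (c\<^sup>2) \<le> cutoff r a CARD('p)" .
qed

end
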